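(* Let $N\ge 1$ and let $(A_k)_{1\le k\le N}$ be events on a probability space $(\Omega,\mathcal F,\mathbb P)$, with the coefficient $\alpha(\cdot)$ fixed by one of the two conventions (ambient: $\alpha=\alpha_A$; or finite restricted: $\alpha=\alpha_N$). Then for each integer $L\ge 0$, $$\mathbb P\Bigl(\bigcup_{k=1}^{N}A_k\Bigr)\ \ge\ \Bigl[\,1-\exp\Bigl(-\frac{S_N}{L+1}\Bigr)-\Bigl\lceil\frac{N}{L+1}\Bigr\rceil\,\alpha(L+1)\Bigr]_{+}.$$ The statement holds under each of the two conventions.
   Context: Notation: $[x]_+=\max(x,0)$ and $S_N=\sum_{k=1}^N\mathbb P(A_k)$. For sub-$\sigma$-algebras $\mathcal A,\mathcal B\subseteq\mathcal F$, $\alpha(\mathcal A,\mathcal B)=\sup\{|\mathbb P(A\cap B)-\mathbb P(A)\mathbb P(B)|: A\in\mathcal A,\ B\in\mathcal B\}$. For integers $a,b\ge1$, $\mathcal F_a^b=\sigma(A_j: a\le j\le b)$ (trivial if $a>b$) and $\mathcal F_a^\infty=\sigma(A_j: j\ge a)$. Ambient convention: the events are the first $N$ members of a sequence $(A_k)_{k\ge1}$, and $\alpha(n)=\alpha_A(n):=\sup_{k\ge1}\alpha(\mathcal F_1^k,\mathcal F_{k+n}^\infty)$. Finite restricted convention: $\alpha(n)=\alpha_N(n):=\sup_{1\le k\le N}\alpha(\mathcal F_1^k,\mathcal F_{k+n}^N)$, where $\mathcal F_a^N$ is trivial when $a>N$. *)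

theory Defs
  imports "HOL-Probability.Probability"
begin

(* The two arguments are families of sets, meant to be sub-sigma-algebras of M. The supremum is
   taken in the reals; for a probability space and nonempty families it is a genuine supremum,
   since all values lie in [0, 1]. *)
definition alpha_coeff :: "'a measure \<Rightarrow> 'a set set \<Rightarrow> 'a set set \<Rightarrow> real" where
  "alpha_coeff M \<A> \<B> =
     (SUP (A, B) \<in> \<A> \<times> \<B>. \<bar>measure M (A \<inter> B) - measure M A * measure M B\<bar>)"

(* F_a^b is the case J = {a..b} and F_a^infinity the case J = {a..}.
   For J = {} this is the trivial sigma-algebra {{}, space M}. *)
definition event_field :: "'a measure \<Rightarrow> (nat \<Rightarrow> 'a set) \<Rightarrow> nat set \<Rightarrow> 'a set set" where
  "event_field M A J = sigma_sets (space M) (A ` J)"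

definition alpha_ambient :: "'a measure \<Rightarrow> (nat \<Rightarrow> 'a set) \<Rightarrow> nat \<Rightarrow> real" where
  "alpha_ambient M A n =
     (SUP k\<in>{1..}. alpha_coeff M (event_field M A {1..k}) (event_field M A {k + n..}))"

(* Depends only on A 1, ..., A N. *)
definition alpha_restricted :: "'a measure \<Rightarrow> (nat \<Rightarrow> 'a set) \<Rightarrow> nat \<Rightarrow> nat \<Rightarrow> real" where
  "alpha_restricted M A N n =
     (SUP k\<in>{1..N}. alpha_coeff M (event_field M A {1..k}) (event_field M A {k + n..N}))"

end

theory Submission
  imports Defs
begin

text \<open>Among the \<open>L + 1\<close> residue classes modulo \<open>L + 1\<close>, at least one carries a share \<open>S\<^sub>N / (L + 1)\<close>
  of the total probability. Its events are \<open>L + 1\<close> apart, so splitting off the last complement one at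
  a time costs \<open>\<alpha>(L + 1)\<close> each and bounds the probability that none of them occurs by
  \<open>\<Prod>(1 - P(A\<^sub>k))\<close>, hence by \<open>exp (- S\<^sub>N / (L + 1))\<close>, up to the accumulated errors.\<close>

lemma space_diff_UN_in_event_field:
  assumes "finite K" "K \<subseteq> J" "A ` J \<subseteq> Pow (space M)"
  shows "space M - (\<Union>k\<in>K. A k) \<in> event_field M A J"
proof -
  interpret sigma_algebra "space M" "event_field M A J"
    unfolding event_field_def by (rule sigma_algebra_sigma_sets[OF assms(3)])
  have "(\<Union>k\<in>K. A k) \<in> event_field M A J"
    using assms(1,2) by (intro finite_UN) (auto simp: event_field_def)
  then show ?thesis by auto
qed

context prob_space
begin

text \<open>This uniform bound makes the families under both real suprema bounded above, so that a
  member can be compared with its \<open>SUP\<close>.\<close>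

lemma covariance_le_one: "\<bar>prob X - prob Y * prob Z\<bar> \<le> 1"
proof -
  have "0 \<le> prob Y * prob Z" "prob Y * prob Z \<le> 1"
    by (simp_all add: mult_le_one)
  then show ?thesis using prob_le_1[of X] measure_nonneg[of M X] by linarith
qed

lemma covariance_le_alpha_coeff:
  assumes "X \<in> \<A>" "Y \<in> \<B>"
  shows "\<bar>prob (X \<inter> Y) - prob X * prob Y\<bar> \<le> alpha_coeff M \<A> \<B>"
proof -
  have "bdd_above ((\<lambda>(X, Y). \<bar>prob (X \<inter> Y) - prob X * prob Y\<bar>) ` (\<A> \<times> \<B>))"
    by (rule bdd_aboveI[of _ 1]) (auto simp: covariance_le_one)
  then show ?thesis
    unfolding alpha_coeff_def using assms
    by (intro cSUP_upper2[of _ _ "(X, Y)"]) auto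
qed

lemma alpha_coeff_event_field_le_one: "alpha_coeff M (event_field M A I) (event_field M A J) \<le> 1"
proof -
  have "{} \<in> event_field M A K" for K
    unfolding event_field_def by (rule sigma_sets.Empty)
  then have "event_field M A I \<times> event_field M A J \<noteq> {}" by blast
  then show ?thesis
    unfolding alpha_coeff_def by (intro cSUP_least) (auto simp: covariance_le_one)
qed

text \<open>The index sets \<open>I k\<close> and \<open>J k\<close> stay abstract so that one
  argument serves both conventions: the future is \<open>{k + n..}\<close> in one and
  \<open>{k + n..N}\<close> in the other.\<close>

lemma covariance_le_SUP_alpha_coeff:
  assumes "k \<in> K" "X \<in> event_field M A (I k)" "Y \<in> event_field M A (J k)"
  shows "\<bar>prob (X \<inter> Y) - prob X * prob Y\<bar>
    \<le> (SUP k\<in>K. alpha_coeff M (event_field M A (I k)) (event_field M A (J k)))"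
  using assms
  by (intro cSUP_upper2[of _ _ k] covariance_le_alpha_coeff bdd_aboveI[of _ 1])
     (auto simp: alpha_coeff_event_field_le_one)

text \<open>Induction adding the largest index last: the earlier complements form the past, and the
  new one is a future at distance at least \<open>q\<close>. Each product factor is replaced by an
  exponential at once, so the induction carries no product.\<close>

lemma prob_avoid_separated_events_le:
  fixes A :: "nat \<Rightarrow> 'a set" and q :: nat and a :: real
  assumes "finite J" "A ` J \<subseteq> events" "0 \<le> a"
    and "\<And>i j. i \<in> J \<Longrightarrow> j \<in> J \<Longrightarrow> i < j \<Longrightarrow> i + q \<le> j"
    and "\<And>k j K. k \<in> J \<Longrightarrow> j \<in> J \<Longrightarrow> k + q \<le> j \<Longrightarrow> K \<subseteq> J \<inter> {..k} \<Longrightarrow>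
      \<bar>prob ((space M - (\<Union>i\<in>K. A i)) \<inter> (space M - A j))
        - prob (space M - (\<Union>i\<in>K. A i)) * prob (space M - A j)\<bar> \<le> a"
  shows "prob (space M - (\<Union>k\<in>J. A k)) \<le> exp (- (\<Sum>k\<in>J. prob (A k))) + card J * a"
  using assms
proof (induction J rule: finite_linorder_max_induct)
  case empty
  then show ?case by (simp add: prob_space)
next
  case (insert b J)
  let ?X = "space M - (\<Union>k\<in>J. A k)" and ?Y = "space M - A b"
  have IH: "prob ?X \<le> exp (- (\<Sum>k\<in>J. prob (A k))) + card J * a"
  proof (rule insert.IH)
    show "i + q \<le> j" if "i \<in> J" "j \<in> J" "i < j" for i j
      using that by (intro insert.prems(3)) auto
    show "\<bar>prob ((space M - (\<Union>i\<in>K. A i)) \<inter> (space M - A j))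
        - prob (space M - (\<Union>i\<in>K. A i)) * prob (space M - A j)\<bar> \<le> a"
      if "k \<in> J" "j \<in> J" "k + q \<le> j" "K \<subseteq> J \<inter> {..k}" for k j K
      using that by (intro insert.prems(4)[of k]) auto
  qed (use insert.prems(1,2) in auto)
  have Y: "prob ?Y = 1 - prob (A b)"
    using insert.prems(1) by (intro prob_compl) auto
  have "prob (?X \<inter> ?Y) \<le> prob ?X * prob ?Y + a"
  \<comment> \<open>With no earlier index there is no \<open>k\<close> for the covariance
    hypothesis. Then \<open>?X\<close> is the whole space and \<open>0 \<le> a\<close>
    suffices.\<close>
  proof (cases "J = {}")
    case True
    then show ?thesis using insert.prems(2) by (simp add: prob_space Int_absorb1)
  next
    \<comment> \<open>\<open>Max J\<close> serves as the time \<open>k\<close>: all of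
      \<open>J\<close> lies in \<open>{..Max J}\<close>, and separation puts \<open>b\<close> at
      least \<open>q\<close> later.\<close>
    case False
    then have max: "Max J \<in> J" and "Max J < b"
      using insert.hyps by auto
    have "\<bar>prob (?X \<inter> ?Y) - prob ?X * prob ?Y\<bar> \<le> a"
      using max insert.hyps \<open>Max J < b\<close>
      by (intro insert.prems(4)[of "Max J"] insert.prems(3)) auto
    then show ?thesis by linarith
  qed
  also have "prob ?X * prob ?Y \<le> (exp (- (\<Sum>k\<in>J. prob (A k))) + card J * a) * prob ?Y"
    using IH by (intro mult_right_mono) auto
  also have "\<dots> = exp (- (\<Sum>k\<in>J. prob (A k))) * prob ?Y + card J * a * prob ?Y"
    by (simp add: algebra_simps)
  \<comment> \<open>The main term uses 1 - p \<le> exp (-p). In the error term the factor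
    \<open>prob ?Y\<close> is bounded by 1, so errors only add up.\<close>
  also have "\<dots> \<le> exp (- (\<Sum>k\<in>J. prob (A k))) * exp (- prob (A b)) + card J * a"
    using insert.prems(2) exp_ge_add_one_self[of "- prob (A b)"]
    by (intro add_mono mult_left_mono mult_left_le) (auto simp: Y)
  finally have "prob (?X \<inter> ?Y) \<le>
      exp (- (\<Sum>k\<in>J. prob (A k))) * exp (- prob (A b)) + card J * a + a"
    by simp
  moreover have "?X \<inter> ?Y = space M - (\<Union>k\<in>insert b J. A k)" by auto
  moreover have "b \<notin> J" using insert.hyps by auto
  ultimately show ?case
    using insert.hyps by (simp add: algebra_simps flip: exp_add)
qed

end

text \<open>Within a class the quotient \<open>(k - 1) div q\<close> determines \<open>k\<close>,
  and k - 1 < N keeps it strictly below N / q, hence below the ceiling.\<close>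

lemma card_residue_class_le:
  fixes N q :: nat
  assumes "q > 0"
  shows "real (card {k \<in> {1..N}. (k - 1) mod q = r}) \<le> of_int \<lceil>real N / real q\<rceil>"
proof -
  let ?J = "{k \<in> {1..N}. (k - 1) mod q = r}"
  have inj: "inj_on (\<lambda>k. (k - 1) div q) ?J"
  proof (rule inj_onI)
    fix x y assume *: "x \<in> ?J" "y \<in> ?J" "(x - 1) div q = (y - 1) div q"
    then have "x - 1 = y - 1"
      by (metis (mono_tags, lifting) div_mod_decomp mem_Collect_eq)
    then show "x = y" using * by auto
  qed
  have "(\<lambda>k. (k - 1) div q) ` ?J \<subseteq> {..<nat \<lceil>real N / real q\<rceil>}"
  proof clarsimp
    fix k assume "Suc 0 \<le> k" "k \<le> N"
    have "real ((k - Suc 0) div q) \<le> real (k - Suc 0) / real q"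
      by (rule of_nat_div_le_of_nat)
    also have "\<dots> < real N / real q"
      using assms \<open>Suc 0 \<le> k\<close> \<open>k \<le> N\<close> by (intro divide_strict_right_mono) auto
    also have "\<dots> \<le> of_int \<lceil>real N / real q\<rceil>" by simp
    finally show "(k - Suc 0) div q < nat \<lceil>real N / real q\<rceil>"
      by linarith
  qed
  then have "card ?J \<le> card {..<nat \<lceil>real N / real q\<rceil>}"
    by (rule card_inj_on_le[OF inj]) simp
  moreover have "0 \<le> \<lceil>real N / real q\<rceil>"
    using divide_nonneg_nonneg[of "real N" "real q"] by linarith
  ultimately show ?thesis by simp linarith
qed

text \<open>The \<open>q\<close> classes partition the indices, so their sums cannot all lie below
  the average.\<close>

lemma residue_class_sum_ge_average:
  fixes f :: "nat \<Rightarrow> real" and N q :: nat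
  assumes "q > 0"
  obtains r where "(\<Sum>k=1..N. f k) / real q \<le> (\<Sum>k\<in>{k \<in> {1..N}. (k - 1) mod q = r}. f k)"
proof -
  let ?s = "\<lambda>r. \<Sum>k\<in>{k \<in> {1..N}. (k - 1) mod q = r}. f k"
  have total: "(\<Sum>r<q. ?s r) = (\<Sum>k=1..N. f k)"
    using assms by (intro sum.group) auto
  have "\<exists>r. (\<Sum>k=1..N. f k) / real q \<le> ?s r"
  proof (rule ccontr)
    assume "\<not> ?thesis"
    then have "(\<Sum>r<q. ?s r) < (\<Sum>r<q. (\<Sum>k=1..N. f k) / real q)"
      using assms by (intro sum_strict_mono) (auto simp: not_le)
    then show False using assms total by simp
  qed
  then show ?thesis using that by blast
qed

text \<open>\<open>q\<close> divides the positive difference j - i. The bound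
  \<open>1 \<le> i\<close> guards against truncated subtraction, which would identify the indices 0
  and 1.\<close>

lemma residue_class_separated:
  fixes i j q :: nat
  assumes "1 \<le> i" "i < j" "(i - 1) mod q = (j - 1) mod q"
  shows "i + q \<le> j"
proof -
  have "q dvd (j - 1) - (i - 1)"
    using assms mod_eq_dvd_iff_nat[of "i - 1" "j - 1" q] by simp
  then have "q \<le> j - i" using assms by (auto dest: dvd_imp_le)
  then show ?thesis using assms by linarith
qed

text \<open>The common core of both conventions: the coefficient enters only as a bound
  \<open>a\<close> on covariances of a past event with a single later complement.\<close>

lemma (in prob_space) prob_UN_ge_mixing:
  fixes A :: "nat \<Rightarrow> 'a set" and N q :: nat and a :: real
  assumes "q > 0" "\<forall>k\<in>{1..N}. A k \<in> events" "0 \<le> a"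
    and cov: "\<And>k j X. 1 \<le> k \<Longrightarrow> j \<le> N \<Longrightarrow> k + q \<le> j \<Longrightarrow> X \<in> event_field M A {1..k} \<Longrightarrow>
      \<bar>prob (X \<inter> (space M - A j)) - prob X * prob (space M - A j)\<bar> \<le> a"
  shows "prob (\<Union>k\<in>{1..N}. A k) \<ge>
    max (1 - exp (- ((\<Sum>k=1..N. prob (A k)) / real q)) - of_int \<lceil>real N / real q\<rceil> * a) 0"
proof -
  obtain r where r: "(\<Sum>k=1..N. prob (A k)) / real q
      \<le> (\<Sum>k\<in>{k \<in> {1..N}. (k - 1) mod q = r}. prob (A k))"
    using residue_class_sum_ge_average[OF assms(1)] .
  let ?J = "{k \<in> {1..N}. (k - 1) mod q = r}"
  have sub: "A ` {1..k} \<subseteq> Pow (space M)" if "k \<le> N" for k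
    using assms(2) that by (intro image_subsetI PowI sets.sets_into_space) auto
  have "prob (space M - (\<Union>k\<in>?J. A k)) \<le> exp (- (\<Sum>k\<in>?J. prob (A k))) + card ?J * a"
  proof (rule prob_avoid_separated_events_le[of _ _ _ q])
    show "i + q \<le> j" if "i \<in> ?J" "j \<in> ?J" "i < j" for i j
      using that by (intro residue_class_separated) auto
    show "\<bar>prob ((space M - (\<Union>i\<in>K. A i)) \<inter> (space M - A j))
        - prob (space M - (\<Union>i\<in>K. A i)) * prob (space M - A j)\<bar> \<le> a"
      if "k \<in> ?J" "j \<in> ?J" "k + q \<le> j" "K \<subseteq> ?J \<inter> {..k}" for k j K
      using that by (intro cov[of k] space_diff_UN_in_event_field sub)
        (auto intro: finite_subset[OF that(4)])
  qed (use assms in auto)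
  \<comment> \<open>The class sum is at least the average, which makes its exponential the smaller
    one; the class size is at most the ceiling.\<close>
  also have "\<dots> \<le> exp (- ((\<Sum>k=1..N. prob (A k)) / real q)) + of_int \<lceil>real N / real q\<rceil> * a"
    using r card_residue_class_le[OF assms(1), of N r] assms(3)
    by (intro add_mono mult_right_mono) auto
  also have "prob (space M - (\<Union>k\<in>?J. A k)) = 1 - prob (\<Union>k\<in>?J. A k)"
    using assms(2) by (intro prob_compl) auto
  finally have "1 - exp (- ((\<Sum>k=1..N. prob (A k)) / real q)) - of_int \<lceil>real N / real q\<rceil> * a
      \<le> prob (\<Union>k\<in>?J. A k)"
    by linarith
  also have "\<dots> \<le> prob (\<Union>k\<in>{1..N}. A k)"
    using assms(2) by (intro finite_measure_mono) auto
  finally show ?thesis by simp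
qed

theorem theorem3p3:
  fixes M :: "'a measure" and A :: "nat \<Rightarrow> 'a set" and N L :: nat
  assumes "prob_space M"
    and "N \<ge> 1"
    and "\<forall>k\<in>{1..N}. A k \<in> sets M"
  shows "((\<forall>k\<ge>1. A k \<in> sets M) \<longrightarrow>
           measure M (\<Union>k\<in>{1..N}. A k) \<ge>
             max (1 - exp (- ((\<Sum>k=1..N. measure M (A k)) / real (L + 1)))
                    - of_int \<lceil>real N / real (L + 1)\<rceil> * alpha_ambient M A (L + 1)) 0)
       \<and> measure M (\<Union>k\<in>{1..N}. A k) \<ge>
             max (1 - exp (- ((\<Sum>k=1..N. measure M (A k)) / real (L + 1)))
                    - of_int \<lceil>real N / real (L + 1)\<rceil> * alpha_restricted M A N (L + 1)) 0"
proof -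
  interpret prob_space M by fact
  have compl: "space M - A j \<in> event_field M A J" if "j \<in> J" "A ` J \<subseteq> events" for j J
    using space_diff_UN_in_event_field[of "{j}" J A M] that sets.space_closed[of M] by simp
  have empty: "{} \<in> event_field M A J" for J
    unfolding event_field_def by (rule sigma_sets.Empty)
  have ambient_ge: "\<bar>prob (X \<inter> Y) - prob X * prob Y\<bar> \<le> alpha_ambient M A (L + 1)"
    if "1 \<le> k" "X \<in> event_field M A {1..k}" "Y \<in> event_field M A {k + (L + 1)..}" for k X Y
    unfolding alpha_ambient_def
    by (rule covariance_le_SUP_alpha_coeff[where k = k]) (use that in auto)
  have restricted_ge: "\<bar>prob (X \<inter> Y) - prob X * prob Y\<bar> \<le> alpha_restricted M A N (L + 1)"
    if "k \<in> {1..N}" "X \<in> event_field M A {1..k}" "Y \<in> event_field M A {k + (L + 1)..N}" for k X Y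
    unfolding alpha_restricted_def
    by (rule covariance_le_SUP_alpha_coeff[where k = k]) (use that in auto)
  show ?thesis
  proof (intro conjI impI)
    assume events: "\<forall>k\<ge>1. A k \<in> events"
    show "prob (\<Union>k\<in>{1..N}. A k) \<ge>
        max (1 - exp (- ((\<Sum>k=1..N. prob (A k)) / real (L + 1)))
               - of_int \<lceil>real N / real (L + 1)\<rceil> * alpha_ambient M A (L + 1)) 0"
    proof (rule prob_UN_ge_mixing)
      show "0 \<le> alpha_ambient M A (L + 1)"
        using ambient_ge[OF _ empty empty, of 1] by simp
      \<comment> \<open>The field of \<open>{k + (L + 1)..}\<close> reaches beyond \<open>N\<close>;
        here measurability of the whole sequence enters.\<close>
      show "\<bar>prob (X \<inter> (space M - A j)) - prob X * prob (space M - A j)\<bar>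
          \<le> alpha_ambient M A (L + 1)"
        if "1 \<le> k" "j \<le> N" "k + (L + 1) \<le> j" "X \<in> event_field M A {1..k}" for k j X
        using that events by (intro ambient_ge[of k] compl) auto
    qed (use assms in auto)
  next
    show "prob (\<Union>k\<in>{1..N}. A k) \<ge>
        max (1 - exp (- ((\<Sum>k=1..N. prob (A k)) / real (L + 1)))
               - of_int \<lceil>real N / real (L + 1)\<rceil> * alpha_restricted M A N (L + 1)) 0"
    proof (rule prob_UN_ge_mixing)
      \<comment> \<open>Two empty sets have covariance 0, and \<open>N \<ge> 1\<close> makes
        \<open>k = 1\<close> an admissible index.\<close>
      show "0 \<le> alpha_restricted M A N (L + 1)"
        using restricted_ge[OF _ empty empty, of 1] assms(2) by simp
      \<comment> \<open>From \<open>k + (L + 1) \<le> j\<close> and \<open>j \<le> N\<close> it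
        follows that \<open>k\<close> lies in \<open>{1..N}\<close>, the range of the restricted
        supremum.\<close>
      show "\<bar>prob (X \<inter> (space M - A j)) - prob X * prob (space M - A j)\<bar>
          \<le> alpha_restricted M A N (L + 1)"
        if "1 \<le> k" "j \<le> N" "k + (L + 1) \<le> j" "X \<in> event_field M A {1..k}" for k j X
        using that assms(3) by (intro restricted_ge[of k] compl) auto
    qed (use assms in auto)
  qed
qed

end
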